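(* Let $m\ge1$, and let $\tilde f$ be a $2m$-closed pentagram lattice map with values in $\mathbb{RP}^2$, or equivalently, let $v:\mathbb Z\to\mathbb{RP}^2$ be $2m$-closed. Assume that the lines $\tilde f_{2i,0}\tilde f_{2i+2,0}=v_iv_{i+1}$ are parallel to the $x$-axis for all $i\in2\mathbb Z$. Assume that the propagation map (the pentagram map $T$) can be applied at least $2m-4$ times. Then $\tilde f_{2m-4}$, or equivalently $T^{2m-4}(v)$, is singular; that is, $\tilde f_{2m-3}$, or equivalently $T^{2m-3}(v)$, is not defined.
   Context: The pentagram map acts on points $(v_i)_{i\in\mathbb Z}$ in $\mathbb{RP}^2$ by $T(v)_i=v_{i-1}v_{i+1}\cap v_iv_{i+2}$, where $v_iv_j$ is the line through $v_i$ and $v_j$. $v$ is $2m$-closed if $v_{i+2m}=v_i$ for all $i$. The pentagram lattice map corresponding to $v$ is $\tilde f_{i,j}=T^j(v)_{(i-j)/2}$ for $i+j$ even, and $\tilde f_j=(\tilde f_{i,j})_{i\equiv j\bmod 2}$; it is $2m$-closed if and only if $v$ is. "Parallel to the $x$-axis" refers to a fixed affine chart of $\mathbb{RP}^2$ (so the lines in question all pass through the same point at infinity). Standing assumption: the data are as generic as possible given the stated constraint.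
   Formalization: The case m = 2 is excluded, since the claim fails there: for a generic trapezoid with v_0v_1 and v_2v_3 parallel to the x-axis, T(v) is defined (constantly the intersection of the diagonals). For m = 1, negative powers of T are read as preimages. *)

theory Defs
  imports "HOL-Analysis.Analysis"
begin

text \<open>The real projective plane: its points are the one-dimensional subspaces of \<open>real ^ 3\<close>,
  its lines the two-dimensional ones, and a point lies on a line if it is contained in it.\<close>

typedef rp2 = "{P :: (real ^ 3) set. subspace P \<and> dim P = 1}"
  morphisms subspace_of Abs_rp2
proof
  show "span {axis 1 1} \<in> {P :: (real ^ 3) set. subspace P \<and> dim P = 1}"
    by (simp add: dim_span dim_singleton axis_eq_0_iff)
qed

text \<open>This is a line only if \<open>p \<noteq> q\<close>, which has to be required wherever it is used.\<close>

definition line_through :: "rp2 \<Rightarrow> rp2 \<Rightarrow> (real ^ 3) set" where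
  "line_through p q = span (subspace_of p \<union> subspace_of q)"

text \<open>The affine chart is \<open>(x, y) \<mapsto> [x : y : 1]\<close>, so the line at infinity is \<open>z = 0\<close>, and a
  line is parallel to the \<open>x\<close>-axis (or equal to it) if it is an affine line that passes through
  the point \<open>[1 : 0 : 0]\<close>.\<close>

definition line_at_infinity :: "(real ^ 3) set" where
  "line_at_infinity = {x. x $ 3 = 0}"

definition parallel_to_x_axis :: "(real ^ 3) set \<Rightarrow> bool" where
  "parallel_to_x_axis l \<longleftrightarrow> axis 1 1 \<in> l \<and> l \<noteq> line_at_infinity"

definition closed_seq :: "nat \<Rightarrow> (int \<Rightarrow> rp2) \<Rightarrow> bool" where
  "closed_seq n v \<longleftrightarrow> (\<forall>i. v (i + int n) = v i)"

text \<open>The pentagram map \<open>T\<close> is partial. It is represented by its graph: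
  \<open>pentagram v w\<close> says that \<open>T\<close> is defined at \<open>v\<close> (for every index the two lines exist and
  are different) and that \<open>T(v) = w\<close>.\<close>

definition pentagram :: "(int \<Rightarrow> rp2) \<Rightarrow> (int \<Rightarrow> rp2) \<Rightarrow> bool" where
  "pentagram v w \<longleftrightarrow>
    (\<forall>i. v (i - 1) \<noteq> v (i + 1) \<and> v i \<noteq> v (i + 2) \<and>
         line_through (v (i - 1)) (v (i + 1)) \<noteq> line_through (v i) (v (i + 2)) \<and>
         subspace_of (w i) =
           line_through (v (i - 1)) (v (i + 1)) \<inter> line_through (v i) (v (i + 2)))"

definition singular :: "(int \<Rightarrow> rp2) \<Rightarrow> bool" where
  "singular v \<longleftrightarrow> (\<nexists>w. pentagram v w)"

text \<open>\<open>pentagram_power k v w\<close> says that \<open>T\<^sup>k(v)\<close> is defined and equal to \<open>w\<close>. For negative \<open>k\<close>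
  this means that \<open>w\<close> is a preimage of \<open>v\<close>, that is \<open>T\<^sup>-\<^sup>k(w) = v\<close>.\<close>

definition pentagram_power :: "int \<Rightarrow> (int \<Rightarrow> rp2) \<Rightarrow> (int \<Rightarrow> rp2) \<Rightarrow> bool" where
  "pentagram_power k v w \<longleftrightarrow>
    (if 0 \<le> k then (pentagram ^^ nat k) v w else (pentagram ^^ nat (- k)) w v)"

definition power_defined :: "int \<Rightarrow> (int \<Rightarrow> rp2) \<Rightarrow> bool" where
  "power_defined k v \<longleftrightarrow> (\<exists>w. pentagram_power k v w)"

text \<open>The case \<open>m = 2\<close> of closed quadrilaterals has to be left out of the main statement: if \<open>v\<close> is a
  trapezoid with two parallel sides \<open>v\<^sub>0v\<^sub>1\<close> and \<open>v\<^sub>2v\<^sub>3\<close>, then its diagonals meet, so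
  \<open>T(v)\<close> is defined (and constant).\<close>

end

(* Put P = [1 : 0 : 0]. After rescaling, the points v_2r and v_(2r+1) have lifts E_r and E_r + P in
   R^3 with E_(r+m) = E_r. The array V(r, s) = v_(2r+s) is a planar quadrilateral net and T is its
   Laplace transform, so every scalar net f(r, s) that satisfies the same four-term relations as
   the lifts is transported along T: the lift of T^k at (r, s) comes with a value that can be
   computed either from column s or from column s + k of f. With n = m - 3, we look for a nonzero
   covector xi and a scalar net that equals xi on column 0 and vanishes on column 2n + 1. Then xi
   vanishes on every second point of T^(2n+1)(v) = T^(2m-5)(v), these points are collinear,
   T^(2m-4)(v) lies on a line, and T^(2m-3)(v) is not defined.

   Crossing from the column of the E_r to that of the E_r + P changes f by a free constant, and the
   linear system for periodic f has one more unknown than equations. If its solution has xi = 0, then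
   summing the columns gives either a solution with xi nonzero or one with fewer columns. *)

theory Submission
  imports Defs
begin

section \<open>Linear algebra\<close>

text \<open>Induction on the equations. Dropping one unknown leaves a solution \<open>x\<close> of
  the earlier equations; dropping an unknown at which \<open>x\<close> is nonzero leaves an
  independent solution \<open>z\<close>. Some combination of the two also satisfies the new
  equation.\<close>

lemma linear_system_nontrivial_solution:
  fixes F :: "'j \<Rightarrow> ('i \<Rightarrow> real) \<Rightarrow> real"
  assumes "finite J" "finite I" "card J < card I"
    and lin: "\<And>j k x z. j \<in> J \<Longrightarrow> F j (\<lambda>i. k * x i + z i) = k * F j x + F j z"
  shows "\<exists>x. (\<exists>i\<in>I. x i \<noteq> 0) \<and> (\<forall>i. i \<notin> I \<longrightarrow> x i = 0) \<and> (\<forall>j\<in>J. F j x = 0)"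
  using assms
proof (induction J arbitrary: I rule: finite_induct)
  case empty
  then obtain i where "i \<in> I" by (metis card.empty equals0I less_irrefl)
  then show ?case by (intro exI[of _ "\<lambda>k. if k = i then 1 else 0"]) auto
next
  case (insert j J)
  note lin = insert.prems(3)
  have sol: "\<exists>x. (\<exists>i\<in>I - {i0}. x i \<noteq> 0) \<and> (\<forall>i. i \<notin> I - {i0} \<longrightarrow> x i = 0) \<and> (\<forall>j\<in>J. F j x = 0)"
    if "i0 \<in> I" for i0
    using insert.prems insert.hyps that by (intro insert.IH) auto
  obtain i0 where "i0 \<in> I" using insert.prems by (metis card.empty equals0I not_less_zero)
  from sol[OF this] obtain x i1 where x: "i1 \<in> I" "x i1 \<noteq> 0" "\<forall>i. i \<notin> I \<longrightarrow> x i = 0" "\<forall>j\<in>J. F j x = 0"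
    by blast
  from sol[OF x(1)] obtain z i2 where z: "i2 \<in> I" "z i2 \<noteq> 0" "z i1 = 0"
     "\<forall>i. i \<notin> I \<longrightarrow> z i = 0" "\<forall>j\<in>J. F j z = 0"
    by blast
  show ?case
  proof (cases "F j z = 0")
    case True
    then show ?thesis using z by (intro exI[of _ z]) auto
  next
    case False
    define k where "k = - F j x / F j z"
    have "F j (\<lambda>i. k * z i + x i) = 0" using False lin[of j k z x] by (simp add: k_def)
    moreover have "F j' (\<lambda>i. k * z i + x i) = 0" if "j' \<in> J" for j'
      using that lin[of j' k z x] x z by simp
    ultimately show ?thesis using x z
      by (intro exI[of _ "\<lambda>i. k * z i + x i"]) (auto intro!: bexI[of _ i1])
  qed
qed

text \<open>This is the 3 by 3 determinant with rows \<open>x\<close>, \<open>y\<close>,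
  \<open>z\<close>.\<close>

definition triple :: "real^3 \<Rightarrow> real^3 \<Rightarrow> real^3 \<Rightarrow> real" where
  "triple x y z = x \<bullet> cross3 y z"

text \<open>Cramer's rule: four vectors in a three-dimensional space satisfy a linear relation whose
  coefficients are, up to sign, the determinants of three of them.\<close>

lemma triple_relation:
  "triple y z w *\<^sub>R x - triple x z w *\<^sub>R y + triple x y w *\<^sub>R z - triple x y z *\<^sub>R w = 0"
  by (simp add: triple_def vec_eq_iff forall_3 inner_vec_def sum_3 cross_components algebra_simps)

lemma covector_with_values:
  assumes "triple p q r \<noteq> 0"
  obtains \<xi> where "\<xi> \<bullet> p = a" "\<xi> \<bullet> q = b" "\<xi> \<bullet> r = c"
proof
  define \<xi> where "\<xi> = (1 / triple p q r) *\<^sub>R (a *\<^sub>R cross3 q r + b *\<^sub>R cross3 r p + c *\<^sub>R cross3 p q)"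
  have v: "cross3 q r \<bullet> p = triple p q r" "cross3 r p \<bullet> q = triple p q r" "cross3 p q \<bullet> r = triple p q r"
    "cross3 q r \<bullet> q = 0" "cross3 q r \<bullet> r = 0" "cross3 r p \<bullet> p = 0" "cross3 r p \<bullet> r = 0"
    "cross3 p q \<bullet> p = 0" "cross3 p q \<bullet> q = 0"
    by (simp_all add: triple_def inner_vec_def sum_3 cross_components algebra_simps)
  show "\<xi> \<bullet> p = a" "\<xi> \<bullet> q = b" "\<xi> \<bullet> r = c"
    using assms by (simp_all add: \<xi>_def inner_add_left v)
qed

text \<open>The vector \<open>cross3 x z\<close> completes \<open>x\<close>, \<open>z\<close> to a
  basis, and in Cramer's relation its coefficient is the vanishing determinant.\<close>

lemma triple_eq_0_in_span:
  assumes "triple x y z = 0" and "cross3 x z \<noteq> 0"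
  shows "y \<in> span {x, z}"
proof -
  define d where "d = cross3 x z"
  have "triple x z d = d \<bullet> d"
    by (simp add: d_def triple_def inner_vec_def sum_3 cross_components algebra_simps)
  then have nz: "triple x z d \<noteq> 0" using assms(2) by (simp add: d_def)
  have "triple x z d *\<^sub>R y = triple y z d *\<^sub>R x + triple x y d *\<^sub>R z"
    using triple_relation[of y z d x] assms(1) by (simp add: algebra_simps)
  then have "y = (1 / triple x z d) *\<^sub>R (triple y z d *\<^sub>R x + triple x y d *\<^sub>R z)"
    using nz by (metis divide_inverse_commute inverse_eq_divide mult_1 real_vector.scale_one
        right_inverse scaleR_scaleR nonzero_divide_eq_eq)
  then show ?thesis
    by (metis insertI1 insertI2 singletonI span_add span_base span_scale)
qed

section \<open>Periodic chains of sequences\<close>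

text \<open>\<open>P\<close> represents the common point of the alternate sides, \<open>E r\<close>
  and \<open>E r + P\<close> are the lifts of \<open>v (2 * r)\<close> and
  \<open>v (2 * r + 1)\<close>, and \<open>rel\<close> is the relation between the lifts of
  \<open>v (2 * r + 1)\<close>, ..., \<open>v (2 * r + 4)\<close>.\<close>

locale periodic_pencil =
  fixes m :: nat and a b c d :: "int \<Rightarrow> real" and E :: "int \<Rightarrow> real^3" and P :: "real^3"
  assumes m3: "m \<ge> 3"
    and per: "E (r + int m) = E r" "a (r + int m) = a r" "b (r + int m) = b r"
      "c (r + int m) = c r" "d (r + int m) = d r"
    and rel: "a r *\<^sub>R (E r + P) + b r *\<^sub>R (E (r + 1) + P) = c r *\<^sub>R E (r + 1) + d r *\<^sub>R E (r + 2)"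
    and d_nz: "d r \<noteq> 0"
    and basis: "triple P (E 0) (E 1) \<noteq> 0"
begin

text \<open>\<open>A\<close> and \<open>B\<close> are the scalar forms of the two sides of
  \<open>rel\<close>: \<open>A\<close> acts on values along the \<open>E r + P\<close>, and
  \<open>B\<close> on values along the \<open>E r\<close> of the next column.\<close>

definition A :: "(int \<Rightarrow> real) \<Rightarrow> int \<Rightarrow> real" where
  "A y r = a r * y r + b r * y (r + 1)"

definition B :: "(int \<Rightarrow> real) \<Rightarrow> int \<Rightarrow> real" where
  "B y r = c r * y (r + 1) + d r * y (r + 2)"

text \<open>A chain \<open>y 0, y 1, \<dots>\<close> that starts at the values of \<open>\<xi>\<close> on \<open>E\<close>, becomes zero after
  \<open>n\<close> steps, and may be changed by a constant \<open>t j\<close> at each step.\<close>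

definition terminating :: "nat \<Rightarrow> real^3 \<Rightarrow> (nat \<Rightarrow> real) \<Rightarrow> (nat \<Rightarrow> int \<Rightarrow> real) \<Rightarrow> bool" where
  "terminating n \<xi> t y \<longleftrightarrow>
     (\<forall>j r. y j (r + int m) = y j r) \<and> (\<forall>r. y 0 r = \<xi> \<bullet> E r - t 0) \<and>
     (\<forall>j r. A (y j) r = B (\<lambda>r. y (Suc j) r + t (Suc j)) r) \<and>
     (\<forall>j\<ge>n. \<forall>r. y j r = 0) \<and> (\<forall>j>n. t j = 0)"

lemma A_sum: "A (\<lambda>r. \<Sum>j\<in>S. y j r) r = (\<Sum>j\<in>S. A (y j) r)"
  by (simp add: A_def sum_distrib_left sum.distrib)

lemma B_sum: "B (\<lambda>r. \<Sum>j\<in>S. y j r) r = (\<Sum>j\<in>S. B (y j) r)"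
  by (simp add: B_def sum_distrib_left sum.distrib)

lemma periodic_mod:
  fixes y :: "int \<Rightarrow> 'b"
  assumes "\<And>r. y (r + int m) = y r"
  shows "y (r mod int m) = y r"
proof -
  have *: "y (r + int k * int m) = y r" for r k
  proof (induction k)
    case (Suc k)
    have "y (r + int (Suc k) * int m) = y ((r + int k * int m) + int m)"
      by (simp add: algebra_simps)
    then show ?case using Suc assms by simp
  qed simp
  have "r = r mod int m + (r div int m) * int m" by simp
  then show ?thesis
  proof (cases "r div int m \<ge> 0")
    case True
    then show ?thesis using *[of "r mod int m" "nat (r div int m)"] by simp
  next
    case False
    then have "r mod int m = r + int (nat (- (r div int m))) * int m"
      by (simp add: minus_div_mult_eq_mod[symmetric])
    then show ?thesis using * by metis
  qed
qed

text \<open>The equation is a second-order recurrence with leading coefficient \<open>d r\<close>,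
  so two initial zeros propagate to all nonnegative indices, and periodicity gives the rest.\<close>

lemma kernel_trivial:
  assumes per: "\<And>r. y (r + int m) = y r" and AB: "\<And>r. A y r = B y r" and y01: "y 0 = 0" "y 1 = 0"
  shows "y r = 0"
proof -
  have "y (int k) = 0 \<and> y (int k + 1) = 0" for k
  proof (induction k)
    case (Suc k)
    have "d (int k) * y (int k + 2) = 0" using AB[of "int k"] Suc by (simp add: A_def B_def)
    then show ?case using Suc d_nz by (simp add: add.commute)
  qed (use y01 in auto)
  then have "y (r mod int m) = 0"
    using m3 by (metis nat_0_le pos_mod_sign of_nat_0_less_iff less_le_trans zero_less_numeral)
  then show ?thesis using periodic_mod[of y] per by simp
qed

text \<open>If \<xi> takes the value -\<tau> on \<open>P\<close>, applying it to \<open>rel\<close>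
  shows that its values on \<open>E\<close>, lowered by \<tau>, form a solution. Its values on
  \<open>E 0\<close> and \<open>E 1\<close> can still be prescribed, and two consecutive values
  determine a solution.\<close>

lemma solution_of_inhomogeneous:
  assumes "\<And>r. y (r + int m) = y r" and AB: "\<And>r. A y r = B (\<lambda>r. y r + \<tau>) r"
  obtains \<xi> where "\<And>r. y r = \<xi> \<bullet> E r - \<tau>" "\<xi> \<bullet> P = - \<tau>"
proof -
  obtain \<xi> where \<xi>: "\<xi> \<bullet> P = - \<tau>" "\<xi> \<bullet> E 0 = y 0 + \<tau>" "\<xi> \<bullet> E 1 = y 1 + \<tau>"
    using covector_with_values[OF basis] .
  define z where "z = (\<lambda>r. y r - (\<xi> \<bullet> E r - \<tau>))"
  have "z r = 0" for r
  proof (rule kernel_trivial)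
    show "z (r + int m) = z r" for r by (simp add: z_def assms per)
    show "A z r = B z r" for r
    proof -
      have "\<xi> \<bullet> (a r *\<^sub>R (E r + P) + b r *\<^sub>R (E (r + 1) + P)) = \<xi> \<bullet> (c r *\<^sub>R E (r + 1) + d r *\<^sub>R E (r + 2))"
        by (simp only: rel)
      then show ?thesis using AB[of r] \<xi>(1)
        by (simp add: A_def B_def z_def inner_add_right algebra_simps)
    qed
  qed (use \<xi> in \<open>simp_all add: z_def\<close>)
  then show ?thesis using that[of \<xi>] \<xi> by (simp add: z_def)
qed

text \<open>The tail sums of a chain form a chain again, whose initial sequence \<open>\<Sum>j. y j\<close> solves the
  inhomogeneous equation and thus comes from a covector. If that covector is zero, the partial sums
  form a shorter chain.\<close>

lemma terminating_nonzero_covector: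
  assumes "terminating n 0 t y" and "\<exists>j. t j \<noteq> 0 \<or> (\<exists>r. y j r \<noteq> 0)"
  shows "\<exists>\<xi> t y. \<xi> \<noteq> 0 \<and> terminating n \<xi> t y"
  using assms
proof (induction n arbitrary: t y)
  case 0
  then have "y 0 r = - t 0" "y j r = 0" "j > 0 \<longrightarrow> t j = 0" for r j
    by (auto simp: terminating_def)
  then show ?case using 0(2) by (metis gr0I neg_equal_0_iff_equal)
next
  case (Suc n)
  let ?N = "Suc n"
  have y: "\<And>j r. y j (r + int m) = y j r" "\<And>r. y 0 r = - t 0"
    "\<And>j r. A (y j) r = B (\<lambda>r. y (Suc j) r + t (Suc j)) r"
    "\<And>j r. j \<ge> ?N \<Longrightarrow> y j r = 0" "\<And>j. j > ?N \<Longrightarrow> t j = 0"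
    using Suc.prems(1) by (auto simp: terminating_def)
  define Y where "Y = (\<lambda>l r. \<Sum>j=l..?N. y j r)"
  define u where "u = (\<lambda>l. \<Sum>j=l..?N. t j)"
  \<comment> \<open>\<open>A\<close> turns the \<open>j\<close>-th summand into the
    \<open>(j + 1)\<close>-st one under \<open>B\<close>; the summand beyond \<open>?N\<close>
    vanishes, so a tail sum passes to the next tail sum.\<close>
  have AY: "A (Y l) r = B (\<lambda>r. Y (Suc l) r + u (Suc l)) r" for l r
  proof -
    have "A (Y l) r = (\<Sum>j=l..?N. B (\<lambda>r. y (Suc j) r + t (Suc j)) r)"
      by (simp add: Y_def A_sum y(3) del: sum.cl_ivl_Suc)
    also have "\<dots> = (\<Sum>j=Suc l..Suc ?N. B (\<lambda>r. y j r + t j) r)"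
      by (simp add: sum.shift_bounds_cl_Suc_ivl del: sum.cl_ivl_Suc)
    also have "\<dots> = (\<Sum>j=Suc l..?N. B (\<lambda>r. y j r + t j) r)"
    proof (rule sum.mono_neutral_right)
      show "\<forall>j\<in>{Suc l..Suc ?N} - {Suc l..?N}. B (\<lambda>r. y j r + t j) r = 0"
        using y(4,5) by (auto simp: B_def)
    qed auto
    also have "\<dots> = B (\<lambda>r. Y (Suc l) r + u (Suc l)) r"
      by (simp add: Y_def u_def B_sum[symmetric] sum.distrib del: sum.cl_ivl_Suc)
    finally show ?thesis .
  qed
  have perY: "Y l (r + int m) = Y l r" for l r by (simp only: Y_def y(1))
  \<comment> \<open>Here the zero covector enters: \<open>y 0\<close> is the constant
    \<open>- t 0\<close>, which \<open>t 0\<close> cancels, so \<open>Y 1 + u 1\<close> equals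
    \<open>Y 0 + u 0\<close> and the equation closes up on \<open>Y 0\<close>.\<close>
  have Y0: "Y 0 r = - t 0 + Y 1 r" and u0: "u 0 = t 0 + u 1" for r
    by (simp_all add: Y_def u_def sum.atLeast_Suc_atMost[of 0] y(2) del: sum.cl_ivl_Suc)
  have "A (Y 0) r = B (\<lambda>r. Y 0 r + u 0) r" for r
    using AY[of 0 r] by (simp add: Y0 u0)
  then obtain \<xi> where \<xi>: "\<And>r. Y 0 r = \<xi> \<bullet> E r - u 0" "\<xi> \<bullet> P = - u 0"
    using solution_of_inhomogeneous perY by metis
  show ?case
  proof (cases "\<xi> = 0")
    case False
    have "Y j r = 0" if "j \<ge> ?N" for j r
      unfolding Y_def by (rule sum.neutral) (use that y(4) in auto)
    moreover have "u j = 0" if "j > ?N" for j using that by (simp add: u_def)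
    ultimately have "terminating ?N \<xi> u Y"
      using \<xi> AY perY by (simp add: terminating_def)
    then show ?thesis using False by blast
  next
    case True
    then have u0: "u 0 = 0" and Y0: "\<And>r. Y 0 r = 0" using \<xi> by simp_all
    define Z where "Z = (\<lambda>l r. \<Sum>j\<le>l. y j r)"
    define w where "w = (\<lambda>l. \<Sum>j\<le>l. t j)"
    have Zw: "Z 0 r = - t 0" "w 0 = t 0" "Z (Suc l) r = Z l r + y (Suc l) r" "w (Suc l) = w l + t (Suc l)" for l r
      by (simp_all add: Z_def w_def y(2))
    have "A (Z l) r = B (\<lambda>r. Z (Suc l) r + w (Suc l)) r" for l r
    proof (induction l)
      case 0
      then show ?case using y(3)[of 0 r] by (simp add: Zw A_def B_def y(2))
    next
      case (Suc l)
      then show ?case using y(3)[of "Suc l" r] by (simp add: Zw A_def B_def algebra_simps)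
    qed
    \<comment> \<open>The full sum \<open>Y 0\<close> vanishes and so does \<open>y ?N\<close>;
      hence the partial sums already vanish from \<open>n\<close> on, which makes the new chain
      shorter by one.\<close>
    moreover have Zend: "Z j r = 0" if "j \<ge> n" for j r
      using that
    proof (induction j rule: dec_induct)
      case base
      have "Z ?N r = 0" using Y0[of r] by (simp only: Z_def Y_def atMost_atLeast0)
      then show ?case using y(4)[of ?N r] by (simp add: Zw)
    next
      case (step j)
      then show ?case using y(4)[of "Suc j"] by (simp add: Zw)
    qed
    moreover have "w j = 0" if "j > n" for j
    proof -
      have "?N \<le> j" using that by simp
      then show ?thesis
      proof (induction j rule: dec_induct)
        case base
        show ?case using u0 by (simp only: w_def u_def atMost_atLeast0)
      next
        case (step j)
        then show ?case using y(5)[of "Suc j"] by (simp add: Zw)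
      qed
    qed
    moreover have "Z l (r + int m) = Z l r" for l r by (simp add: Z_def y(1))
    ultimately have tZ: "terminating n 0 w Z" by (simp add: terminating_def Zw)
    \<comment> \<open>The old chain consists of successive differences of the new one, so the new
      chain cannot be zero.\<close>
    have "\<exists>j. w j \<noteq> 0 \<or> (\<exists>r. Z j r \<noteq> 0)"
    proof (rule ccontr)
      assume "\<not> ?thesis"
      then have "w j = 0" "Z j r = 0" for j r by auto
      then have "t j = 0 \<and> y j r = 0" for j r
        using Zw(1,2) Zw(3,4)[of "j - 1"] y(2) by (cases j) auto
      then show False using Suc.prems(2) by blast
    qed
    from Suc.IH[OF tZ this] obtain \<xi> t y where "\<xi> \<noteq> 0" "terminating n \<xi> t y" by blast
    moreover from this have "terminating ?N \<xi> t y" by (simp add: terminating_def)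
    ultimately show ?thesis by blast
  qed
qed

text \<open>With \<open>n = m - 3\<close> there are \<open>n * m\<close> values of the
  \<open>y j\<close>, \<open>n + 1\<close> constants \<open>t j\<close> and 3 coordinates of \<xi>.
  The initial condition and the \<open>n\<close> steps give
  \<open>(n + 1) * m = n * m + n + 3\<close> equations, one fewer than the unknowns.\<close>

lemma terminating_exists:
  "\<exists>\<xi> t y. \<xi> \<noteq> 0 \<and> terminating (m - 3) \<xi> t y"
proof -
  define n where "n = m - 3"
  have m: "m = n + 3" using m3 by (simp add: n_def)
  \<comment> \<open>Unknowns are coded as pairs: \<open>(j, r)\<close> with \<open>r < m\<close> for
    \<open>y j r\<close>, \<open>(j, m)\<close> for \<open>t j\<close>, and
    \<open>(n + 1, l)\<close> for the coordinates of \<xi>.\<close>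
  define I where "I = {..<n} \<times> {..<m} \<union> {..n} \<times> {m} \<union> {n + 1} \<times> {..<3}"
  define J where "J = {..n} \<times> {..<m}"
  define y where "y = (\<lambda>x j r. if j < n then x (j, nat (r mod int m)) else (0 :: real))"
  define t where "t = (\<lambda>x j. if j \<le> n then x (j, m) else (0 :: real))"
  define \<xi> :: "(nat \<times> nat \<Rightarrow> real) \<Rightarrow> real^3" where
    "\<xi> = (\<lambda>x. x (n + 1, 0) *\<^sub>R axis 1 1 + x (n + 1, 1) *\<^sub>R axis 2 1 + x (n + 1, 2) *\<^sub>R axis 3 1)"
  define F where "F = (\<lambda>p x. if fst p = 0 then y x 0 (int (snd p)) - (\<xi> x \<bullet> E (int (snd p)) - t x 0)
     else A (y x (fst p - 1)) (int (snd p)) - B (\<lambda>r. y x (fst p) r + t x (fst p)) (int (snd p)))"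
  have "card I = n * m + (n + 1) + 3"
  proof -
    have "card ({..<n} \<times> {..<m} \<union> {..n} \<times> {m}) = n * m + (n + 1)"
      by (subst card_Un_disjoint) auto
    then show ?thesis unfolding I_def
      by (subst card_Un_disjoint) auto
  qed
  then have card: "card J < card I" by (simp add: J_def m)
  have lin: "F p (\<lambda>i. k * x i + z i) = k * F p x + F p z" for p k x z
    by (simp add: F_def y_def t_def \<xi>_def A_def B_def inner_add_left algebra_simps) arith
  have "finite I" "finite J" by (simp_all add: I_def J_def)
  with linear_system_nontrivial_solution[of J I F] card lin
  obtain x i where x: "i \<in> I" "x i \<noteq> 0" "\<And>j. j \<in> J \<Longrightarrow> F j x = 0" by metis
  have pery: "y x j (r + int m) = y x j r" for j r by (simp add: y_def)
  have eq: "F (j, nat (r mod int m)) x = 0" if "j \<le> n" for j r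
  proof (rule x(3))
    show "(j, nat (r mod int m)) \<in> J" using that m by (simp add: J_def nat_less_iff)
  qed
  have int_mod: "int (nat (r mod int m)) = r mod int m" for r using m by simp
  have mod: "f (r mod int m + 1) = f (r + 1)" "f (r mod int m + 2) = f (r + 2)" "f (r mod int m) = f r"
    if "\<And>r. f (r + int m) = f r" for f :: "int \<Rightarrow> 'x" and r
  proof -
    have "f (r mod int m + k) = f (r + k)" for k
      using periodic_mod[of f "r mod int m + k"] periodic_mod[of f "r + k"] that
      by (simp add: mod_add_left_eq)
    from this[of 1] this[of 2] this[of 0]
    show "f (r mod int m + 1) = f (r + 1)" "f (r mod int m + 2) = f (r + 2)" "f (r mod int m) = f r"
      by simp_all
  qed
  note mods = mod[of "y x j" for j, OF pery] mod[of E, OF per(1)] mod[of a, OF per(2)]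
    mod[of b, OF per(3)] mod[of c, OF per(4)] mod[of d, OF per(5)]
  have y0: "y x 0 r = \<xi> x \<bullet> E r - t x 0" for r
    using eq[of 0 r] by (simp add: F_def int_mod mods del: int_nat_eq)
  have step: "A (y x j) r = B (\<lambda>r. y x (Suc j) r + t x (Suc j)) r" for j r
  proof (cases "j < n")
    case True
    then show ?thesis using eq[of "Suc j" r] by (simp add: F_def int_mod A_def B_def mods del: int_nat_eq)
  next
    case False
    then show ?thesis by (simp add: y_def t_def A_def B_def)
  qed
  have sol: "terminating n (\<xi> x) (t x) (y x)"
    using y0 step pery by (simp add: terminating_def) (simp add: y_def t_def)
  show ?thesis
  proof (cases "\<xi> x = 0")
    case False
    then show ?thesis using sol n_def by blast
  next
    case True
    have c: "\<xi> x $ 1 = x (n + 1, 0)" "\<xi> x $ 2 = x (n + 1, 1)" "\<xi> x $ 3 = x (n + 1, 2)"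
      by (simp_all add: \<xi>_def axis_def)
    consider j r where "i = (j, r)" "j < n" "r < m" | j where "i = (j, m)" "j \<le> n"
      | l where "i = (n + 1, l)" "l < 3"
      using x(1) unfolding I_def by auto
    then have "\<exists>j. t x j \<noteq> 0 \<or> (\<exists>r. y x j r \<noteq> 0)"
    proof cases
      case 1
      then have "y x j (int r) \<noteq> 0" using x(2) by (simp add: y_def)
      then show ?thesis by blast
    next
      case 2
      then have "t x j \<noteq> 0" using x(2) by (simp add: t_def)
      then show ?thesis by blast
    next
      case 3
      then have "l = 0 \<or> l = 1 \<or> l = 2" by auto
      then show ?thesis using 3 c x(2) True by auto
    qed
    then show ?thesis using terminating_nonzero_covector sol True n_def by metis
  qed
qed

end

section \<open>Points and lines\<close>

lemma subspace_subspace_of [simp]: "subspace (subspace_of p)"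
  using subspace_of[of p] by simp

lemma dim_subspace_of [simp]: "dim (subspace_of p) = 1"
  using subspace_of[of p] by simp

lemma subspace_of_eqI: "subspace_of p \<subseteq> subspace_of q \<Longrightarrow> p = q"
  by (metis subspace_dim_equal subspace_subspace_of dim_subspace_of le_refl subspace_of_inject)

lemma subspace_of_eq_span:
  assumes "x \<in> subspace_of p" "x \<noteq> 0"
  shows "subspace_of p = span {x}"
proof -
  have "span {x} \<subseteq> subspace_of p" using assms by (simp add: span_minimal)
  then show ?thesis using assms
    by (metis subspace_dim_equal subspace_subspace_of dim_subspace_of subspace_span dim_span
        dim_singleton le_refl)
qed

lemma subspace_of_eq_span_ex:
  obtains x where "subspace_of p = span {x}" "x \<noteq> 0"
proof -
  have "subspace_of p \<noteq> {0}" by (metis dim_subspace_of dim_eq_0 order_refl zero_neq_one)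
  then obtain x where "x \<in> subspace_of p" "x \<noteq> 0"
    using subspace_0[OF subspace_subspace_of[of p]] by blast
  then show ?thesis using that subspace_of_eq_span by blast
qed

lemma span_eq_subspace_of_nonzero: "subspace_of p = span {x} \<Longrightarrow> x \<noteq> 0"
  by (metis dim_subspace_of dim_span dim_singleton zero_neq_one)

lemma line_through_eq_span:
  assumes "subspace_of p = span {x}" "subspace_of q = span {y}"
  shows "line_through p q = span {x, y}"
  unfolding line_through_def assms
proof (rule span_eq[THEN iffD2], intro conjI)
  show "span {x} \<union> span {y} \<subseteq> span {x, y}" by (simp add: span_mono)
  show "{x, y} \<subseteq> span (span {x} \<union> span {y})" by (auto intro: span_base)
qed

lemma subspace_line_through [simp]: "subspace (line_through p q)"
  by (simp add: line_through_def)

lemma left_in_line_through: "subspace_of p \<subseteq> line_through p q"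
  and right_in_line_through: "subspace_of q \<subseteq> line_through p q"
  by (auto simp: line_through_def intro: span_base)

lemma line_through_subset:
  assumes "subspace_of p \<subseteq> S" "subspace_of q \<subseteq> S" "subspace S"
  shows "line_through p q \<subseteq> S"
  unfolding line_through_def using assms by (intro span_minimal) auto

lemma distinct_points_independent:
  assumes "p \<noteq> q" "subspace_of p = span {x}" "subspace_of q = span {y}" "a *\<^sub>R x + b *\<^sub>R y = 0"
  shows "a = 0" "b = 0"
proof -
  have nz: "x \<noteq> 0" "y \<noteq> 0" using assms span_eq_subspace_of_nonzero by auto
  have "a = 0"
  proof (rule ccontr)
    assume "a \<noteq> 0"
    have "a *\<^sub>R x = (- b) *\<^sub>R y" using assms(4) by (simp add: eq_neg_iff_add_eq_0)
    then have "x = (- b / a) *\<^sub>R y" using \<open>a \<noteq> 0\<close>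
      by (metis divide_inverse_commute scaleR_scaleR left_inverse scaleR_one)
    then have "x \<in> span {y}" by (metis singletonI span_base span_scale)
    then show False using assms nz subspace_of_eq_span subspace_of_inject by metis
  qed
  then show "a = 0" "b = 0" using assms(4) nz by auto
qed

lemma dim_line_through:
  assumes "p \<noteq> q"
  shows "dim (line_through p q) = 2"
proof -
  obtain x y where xy: "subspace_of p = span {x}" "x \<noteq> 0" "subspace_of q = span {y}" "y \<noteq> 0"
    using subspace_of_eq_span_ex by metis
  have "x \<notin> span {y}" using assms xy subspace_of_eq_span subspace_of_inject by metis
  then show ?thesis using xy by (simp add: line_through_eq_span dim_insert)
qed

lemma line_through_unique:
  assumes "p \<noteq> q" "subspace_of p \<subseteq> S" "subspace_of q \<subseteq> S" "subspace S" "dim S = 2"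
  shows "line_through p q = S"
  using assms line_through_subset dim_line_through
  by (metis subspace_dim_equal subspace_line_through order_refl)

lemma pentagram_in_lines:
  assumes "pentagram v w"
  shows "subspace_of (w i) \<subseteq> line_through (v (i - 1)) (v (i + 1))"
    "subspace_of (w i) \<subseteq> line_through (v i) (v (i + 2))"
  using assms unfolding pentagram_def by auto

text \<open>Otherwise \<open>w i = w (i + 1) = v (i + 1)\<close>, and then \<open>x (i - 1) = x (i + 1)\<close>.\<close>

lemma no_three_consecutive_collinear:
  assumes "pentagram v w" "pentagram w x" "\<exists>y. pentagram x y"
  shows "\<not> subspace_of (v (i + 1)) \<subseteq> line_through (v i) (v (i + 2))"
proof
  assume *: "subspace_of (v (i + 1)) \<subseteq> line_through (v i) (v (i + 2))"
  have w: "subspace_of (w j) = line_through (v (j - 1)) (v (j + 1)) \<inter> line_through (v j) (v (j + 2))" for j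
    using assms(1) unfolding pentagram_def by blast
  have x: "subspace_of (x j) = line_through (w (j - 1)) (w (j + 1)) \<inter> line_through (w j) (w (j + 2))" for j
    using assms(2) unfolding pentagram_def by blast
  have "subspace_of (v (i + 1)) \<subseteq> subspace_of (w i)"
    unfolding w[of i] using * right_in_line_through by blast
  then have wi: "w i = v (i + 1)" using subspace_of_eqI by metis
  have "subspace_of (v (i + 1)) \<subseteq> subspace_of (w (i + 1))"
    unfolding w[of "i + 1"] using * left_in_line_through by (simp add: add.commute)
  then have wi1: "w (i + 1) = v (i + 1)" using subspace_of_eqI by metis
  have "i - 1 + 2 = i + 1" by simp
  then have "subspace_of (v (i + 1)) \<subseteq> subspace_of (x (i - 1))"
    unfolding x[of "i - 1"] using right_in_line_through[of "w i" "w (i - 2)"]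
      right_in_line_through[of "w (i + 1)" "w (i - 1)"]
    by (simp only: wi wi1 le_inf_iff diff_add_cancel diff_diff_eq) (simp add: wi wi1)
  moreover have "subspace_of (v (i + 1)) \<subseteq> subspace_of (x (i + 1))"
    unfolding x[of "i + 1"] using left_in_line_through[of "w i"] left_in_line_through[of "w (i + 1)"] wi wi1
    by (simp add: add.commute)
  ultimately have "x (i - 1) = x (i + 1)" using subspace_of_eqI by metis
  then show False using assms(3) unfolding pentagram_def by blast
qed

section \<open>Transporting scalar nets along the pentagram map\<close>

text \<open>The index \<open>N\<close> stands for \<open>2r + s\<close>, where \<open>s\<close> is the column; hence \<open>\<phi> s N\<close> is only meaningful
  if \<open>s\<close> and \<open>N\<close> have the same parity. In this indexing \<open>T\<^sup>k(v)\<close> at \<open>N + k\<close> is the \<open>k\<close>-th Laplace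
  transform at \<open>N\<close>.\<close>

definition planar_net :: "(int \<Rightarrow> real^3) \<Rightarrow> (nat \<Rightarrow> int \<Rightarrow> real) \<Rightarrow> bool" where
  "planar_net X \<phi> \<longleftrightarrow> (\<forall>N. \<exists>a b c d. (a \<noteq> 0 \<or> b \<noteq> 0 \<or> c \<noteq> 0 \<or> d \<noteq> 0) \<and>
     a *\<^sub>R X N + b *\<^sub>R X (N + 2) = c *\<^sub>R X (N + 1) + d *\<^sub>R X (N + 3) \<and>
     (\<forall>s. even (int s + N) \<longrightarrow>
        a * \<phi> s N + b * \<phi> s (N + 2) = c * \<phi> (Suc s) (N + 1) + d * \<phi> (Suc s) (N + 3)))"

text \<open>The equations compare the coefficients of three old points in a relation between four
  new ones; the digits in the names are the offsets of the indices plus one.\<close>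

lemma three_equations_four_unknowns:
  fixes c1 a2 d1 c3 b2 a4 d3 b4 :: real
  obtains a b c d where "a \<noteq> 0 \<or> b \<noteq> 0 \<or> c \<noteq> 0 \<or> d \<noteq> 0"
    "a * c1 = c * a2" "a * d1 + b * c3 = c * b2 + d * a4" "b * d3 = d * b4"
proof -
  define F where "F = (\<lambda>j (x :: nat \<Rightarrow> real). if j = (0::nat) then x 0 * c1 - x 2 * a2
     else if j = 1 then x 0 * d1 + x 1 * c3 - x 2 * b2 - x 3 * a4 else x 1 * d3 - x 3 * b4)"
  have "\<exists>x. (\<exists>i\<in>{..<4}. x i \<noteq> 0) \<and> (\<forall>i. i \<notin> {..<4} \<longrightarrow> x i = 0) \<and> (\<forall>j\<in>{..<3}. F j x = 0)"
    by (rule linear_system_nontrivial_solution) (auto simp: F_def algebra_simps)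
  then obtain x i where x: "i < 4" "x i \<noteq> 0" "\<And>j. j < 3 \<Longrightarrow> F j x = 0" by auto
  have "i = 0 \<or> i = 1 \<or> i = 2 \<or> i = 3" using x(1) by auto
  then show ?thesis using that[of "x 0" "x 1" "x 2" "x 3"] x(2) x(3)[of 0] x(3)[of 1] x(3)[of 2]
    by (auto simp: F_def)
qed

text \<open>All four new points at \<open>N, \<dots>, N + 3\<close> are combinations of the three old points at
  \<open>N + 1\<close>, \<open>N + 3\<close>, \<open>N + 5\<close>. So their relation follows from the old coefficients alone and is
  shared by the scalar net.\<close>

lemma planar_net_step:
  assumes net: "planar_net X \<phi>" and pent: "pentagram u w" and X: "\<And>N. subspace_of (u (N + k)) = span {X N}"
  shows "\<exists>X' \<phi>'. planar_net X' \<phi>' \<and> (\<forall>N. subspace_of (w (N + (k + 1))) = span {X' N}) \<and>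
    (\<forall>\<xi> s. (\<forall>N. even (int s + N) \<longrightarrow> \<phi> s N = \<xi> \<bullet> X N) \<longrightarrow> (\<forall>N. even (int s + N) \<longrightarrow> \<phi>' s N = \<xi> \<bullet> X' N)) \<and>
    (\<forall>s. (\<forall>N. even (int (Suc s) + N) \<longrightarrow> \<phi> (Suc s) N = 0) \<longrightarrow> (\<forall>N. even (int s + N) \<longrightarrow> \<phi>' s N = 0))"
proof -
  from net obtain a b c d where nz: "\<And>N. a N \<noteq> 0 \<or> b N \<noteq> 0 \<or> c N \<noteq> 0 \<or> d N \<noteq> 0"
    and rel: "\<And>N. a N *\<^sub>R X N + b N *\<^sub>R X (N + 2) = c N *\<^sub>R X (N + 1) + d N *\<^sub>R X (N + 3)"
    and relf: "\<And>N s. even (int s + N) \<Longrightarrow>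
        a N * \<phi> s N + b N * \<phi> s (N + 2) = c N * \<phi> (Suc s) (N + 1) + d N * \<phi> (Suc s) (N + 3)"
    unfolding planar_net_def by metis
  \<comment> \<open>By \<open>rel\<close> the same vector is a combination of
    \<open>X (N + 1)\<close> and \<open>X (N + 3)\<close>, so it lies on both lines that meet in the
    new point.\<close>
  define X' where "X' = (\<lambda>N. a N *\<^sub>R X N + b N *\<^sub>R X (N + 2))"
  define \<phi>' where "\<phi>' = (\<lambda>s N. a N * \<phi> s N + b N * \<phi> s (N + 2))"
  have "planar_net X' \<phi>'"
    unfolding planar_net_def
  proof
    fix N
    obtain p q r t where pqrt: "p \<noteq> 0 \<or> q \<noteq> 0 \<or> r \<noteq> 0 \<or> t \<noteq> 0"
      "p * c N = r * a (N + 1)" "p * d N + q * c (N + 2) = r * b (N + 1) + t * a (N + 3)"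
      "q * d (N + 2) = t * b (N + 3)"
      by (rule three_equations_four_unknowns)
    have "p *\<^sub>R X' N + q *\<^sub>R X' (N + 2) =
        (p * c N) *\<^sub>R X (N + 1) + (p * d N + q * c (N + 2)) *\<^sub>R X (N + 3) + (q * d (N + 2)) *\<^sub>R X (N + 5)"
      by (simp add: X'_def rel algebra_simps)
    also have "\<dots> = r *\<^sub>R X' (N + 1) + t *\<^sub>R X' (N + 3)"
      unfolding pqrt by (simp add: X'_def algebra_simps)
    finally have 1: "p *\<^sub>R X' N + q *\<^sub>R X' (N + 2) = r *\<^sub>R X' (N + 1) + t *\<^sub>R X' (N + 3)" .
    have 2: "p * \<phi>' s N + q * \<phi>' s (N + 2) = r * \<phi>' (Suc s) (N + 1) + t * \<phi>' (Suc s) (N + 3)"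
      if "even (int s + N)" for s
    proof -
      have e: "even (int s + (N + 2))" using that by simp
      have "p * \<phi>' s N + q * \<phi>' s (N + 2) = (p * c N) * \<phi> (Suc s) (N + 1)
          + (p * d N + q * c (N + 2)) * \<phi> (Suc s) (N + 3) + (q * d (N + 2)) * \<phi> (Suc s) (N + 5)"
        using relf[OF that] relf[OF e] by (simp add: \<phi>'_def algebra_simps)
      also have "\<dots> = r * \<phi>' (Suc s) (N + 1) + t * \<phi>' (Suc s) (N + 3)"
        unfolding pqrt by (simp add: \<phi>'_def algebra_simps)
      finally show ?thesis .
    qed
    show "\<exists>a b c d. (a \<noteq> 0 \<or> b \<noteq> 0 \<or> c \<noteq> 0 \<or> d \<noteq> 0) \<and>
     a *\<^sub>R X' N + b *\<^sub>R X' (N + 2) = c *\<^sub>R X' (N + 1) + d *\<^sub>R X' (N + 3) \<and>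
     (\<forall>s. even (int s + N) \<longrightarrow>
        a * \<phi>' s N + b * \<phi>' s (N + 2) = c * \<phi>' (Suc s) (N + 1) + d * \<phi>' (Suc s) (N + 3))"
      using pqrt(1) 1 2 by blast
  qed
  moreover have "subspace_of (w (N + (k + 1))) = span {X' N}" for N
  proof (rule subspace_of_eq_span)
    have idx: "N + (k + 1) - 1 = N + k" "N + (k + 1) + 1 = (N + 2) + k"
      "N + (k + 1) + 2 = (N + 3) + k" by simp_all
    have idx1: "u (N + (k + 1)) = u ((N + 1) + k)" by (simp add: add_ac)
    note P = pent[unfolded pentagram_def, rule_format, of "N + (k + 1)", unfolded idx idx1]
    have w: "subspace_of (w (N + (k + 1))) = span {X N, X (N + 2)} \<inter> span {X (N + 1), X (N + 3)}"
      using P by (simp only: line_through_eq_span[OF X X])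
    have ne: "u (N + k) \<noteq> u ((N + 2) + k)" "u ((N + 1) + k) \<noteq> u ((N + 3) + k)"
      using P by simp_all
    have "X' N \<in> span {X N, X (N + 2)}"
      unfolding X'_def by (intro span_add span_scale span_base) auto
    moreover have "X' N \<in> span {X (N + 1), X (N + 3)}"
      unfolding X'_def rel by (intro span_add span_scale span_base) auto
    ultimately show "X' N \<in> subspace_of (w (N + (k + 1)))" by (simp add: w)
    \<comment> \<open>If it were zero, both sides of the relation would vanish, and the independence
      of distinct points would make all four coefficients zero.\<close>
    show "X' N \<noteq> 0"
      using distinct_points_independent[OF ne(1) X X] distinct_points_independent[OF ne(2) X X]
        nz[of N] rel[of N] unfolding X'_def by metis
  qed
  moreover have "\<phi>' s N = \<xi> \<bullet> X' N"
    if "\<forall>N. even (int s + N) \<longrightarrow> \<phi> s N = \<xi> \<bullet> X N" "even (int s + N)" for \<xi> s N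
    using that by (simp add: \<phi>'_def X'_def inner_add_right)
  \<comment> \<open>The other side of the relation expresses the new column \<open>s\<close> through
    the old column \<open>Suc s\<close>.\<close>
  moreover have "\<phi>' s N = 0"
    if "\<forall>N. even (int (Suc s) + N) \<longrightarrow> \<phi> (Suc s) N = 0" "even (int s + N)" for s N
    using that relf[OF that(2)] by (simp add: \<phi>'_def)
  ultimately show ?thesis by blast
qed

text \<open>Each step moves the zero column one place to the left, while column 0 keeps the values
  of \<xi>. After \<open>K\<close> steps the two columns coincide, so \<xi> vanishes on the points
  there.\<close>

lemma planar_net_iterate:
  assumes net: "planar_net X \<phi>" and X: "\<And>N. subspace_of (U 0 N) = span {X N}"
    and pent: "\<And>k. k < K \<Longrightarrow> pentagram (U k) (U (Suc k))"
    and first: "\<And>N. even N \<Longrightarrow> \<phi> 0 N = \<xi> \<bullet> X N"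
    and last: "\<And>N. even (int K + N) \<Longrightarrow> \<phi> K N = 0"
    and "even N" "x \<in> subspace_of (U K (N + int K))"
  shows "\<xi> \<bullet> x = 0"
proof -
  have "\<exists>X \<phi>. planar_net X \<phi> \<and> (\<forall>N. subspace_of (U k (N + int k)) = span {X N})
      \<and> (\<forall>N. even N \<longrightarrow> \<phi> 0 N = \<xi> \<bullet> X N) \<and> (\<forall>N. even (int (K - k) + N) \<longrightarrow> \<phi> (K - k) N = 0)"
    if "k \<le> K" for k
    using that
  proof (induction k)
    case 0
    then show ?case using net X first last by (intro exI[of _ X] exI[of _ \<phi>]) simp
  next
    case (Suc k)
    then obtain X \<phi> where IH: "planar_net X \<phi>" "\<And>N. subspace_of (U k (N + int k)) = span {X N}"
      "\<And>N. even N \<Longrightarrow> \<phi> 0 N = \<xi> \<bullet> X N" "\<And>N. even (int (K - k) + N) \<Longrightarrow> \<phi> (K - k) N = 0"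
      by (meson Suc_leD)
    have pk: "pentagram (U k) (U (Suc k))" using pent Suc.prems by simp
    obtain X' \<phi>' where S: "planar_net X' \<phi>'"
      "\<forall>N. subspace_of (U (Suc k) (N + (int k + 1))) = span {X' N}"
      "\<forall>\<xi> s. (\<forall>N. even (int s + N) \<longrightarrow> \<phi> s N = \<xi> \<bullet> X N) \<longrightarrow> (\<forall>N. even (int s + N) \<longrightarrow> \<phi>' s N = \<xi> \<bullet> X' N)"
      "\<forall>s. (\<forall>N. even (int (Suc s) + N) \<longrightarrow> \<phi> (Suc s) N = 0) \<longrightarrow> (\<forall>N. even (int s + N) \<longrightarrow> \<phi>' s N = 0)"
      using planar_net_step[OF IH(1) pk IH(2)] by blast
    have eq: "K - k = Suc (K - Suc k)" using Suc.prems by simp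
    have "\<phi>' 0 N = \<xi> \<bullet> X' N" if "even N" for N using S(3)[rule_format, of 0 \<xi> N] IH(3) that by simp
    moreover have "\<phi>' (K - Suc k) N = 0" if "even (int (K - Suc k) + N)" for N
      using S(4) IH(4) that unfolding eq by blast
    moreover have "int k + 1 = int (Suc k)" by simp
    ultimately show ?case using S(1) S(2)
      by (intro exI[of _ X'] exI[of _ \<phi>']) (simp add: algebra_simps)
  qed
  from this[of K] obtain Y \<psi> where Y: "\<And>N. subspace_of (U K (N + int K)) = span {Y N}"
    "\<And>N. even N \<Longrightarrow> \<psi> 0 N = \<xi> \<bullet> Y N" "\<And>N. even N \<Longrightarrow> \<psi> 0 N = (0::real)" by auto
  then have "\<xi> \<bullet> Y N = 0" using \<open>even N\<close> by metis
  moreover obtain k where "x = k *\<^sub>R Y N" using assms(7) Y(1) by (auto simp: span_singleton)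
  ultimately show ?thesis by simp
qed

section \<open>Polygons with concurrent alternate sides\<close>

text \<open>Write \<open>e\<close> as a combination of representatives of \<open>p\<close> and
  \<open>q\<close>. Both coefficients are nonzero, so the two terms, the first one negated, are the
  lifts.\<close>

lemma lift_with_difference:
  assumes "p \<noteq> q" "e \<in> line_through p q" "e \<notin> subspace_of p" "e \<notin> subspace_of q"
  shows "\<exists>x. subspace_of p = span {x} \<and> subspace_of q = span {x + e}"
proof -
  obtain x y where xy: "subspace_of p = span {x}" "x \<noteq> 0" "subspace_of q = span {y}" "y \<noteq> 0"
    using subspace_of_eq_span_ex by metis
  have "e \<in> span {x, y}" using assms(2) xy by (simp add: line_through_eq_span)
  then obtain s where "e - s *\<^sub>R x \<in> span {y}" by (auto simp: span_insert)
  then obtain t where "e - s *\<^sub>R x = t *\<^sub>R y" by (auto simp: span_singleton)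
  then have e: "e = s *\<^sub>R x + t *\<^sub>R y" by (simp add: algebra_simps)
  have "s \<noteq> 0" "t \<noteq> 0" using e assms(3,4) xy by (auto simp: span_base span_scale)
  have 1: "subspace_of p = span {- s *\<^sub>R x}"
    by (rule subspace_of_eq_span) (use \<open>s \<noteq> 0\<close> xy in \<open>simp_all add: span_base span_scale span_neg\<close>)
  have "subspace_of q = span {t *\<^sub>R y}"
    by (rule subspace_of_eq_span) (use \<open>t \<noteq> 0\<close> xy in \<open>simp_all add: span_base span_scale\<close>)
  then have "subspace_of q = span {- s *\<^sub>R x + e}" by (simp add: e)
  then show ?thesis using 1 by blast
qed

lemma triple_nonzero:
  assumes "subspace_of p = span {x}" "subspace_of q = span {y}" "subspace_of r = span {z}"
    "p \<noteq> r" "\<not> subspace_of q \<subseteq> line_through p r"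
  shows "triple x y z \<noteq> 0"
proof
  assume "triple x y z = 0"
  have "cross3 x z \<noteq> 0"
  proof
    assume "cross3 x z = 0"
    then consider "x = 0" | "z = 0" | k where "z = k *\<^sub>R x"
      unfolding cross_eq_0 collinear_lemma by blast
    then show False
    proof cases
      case 3
      then have "subspace_of r \<subseteq> subspace_of p"
        using assms by (simp add: span_minimal span_base span_scale)
      then show False using subspace_of_eqI assms(4) by metis
    qed (use assms span_eq_subspace_of_nonzero in blast)+
  qed
  then have "y \<in> span {x, z}" using \<open>triple x y z = 0\<close> triple_eq_0_in_span by blast
  then show False using assms by (simp add: line_through_eq_span span_minimal)
qed

text \<open>In a preimage \<open>z\<close>, both \<open>v 0\<close> and \<open>v 1\<close> would lie
  on the line through \<open>z 0\<close>, \<open>z 2\<close> and on the line through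
  \<open>z 1\<close>, \<open>z 3\<close>. These lines would coincide.\<close>

lemma no_backward_step_from_digon:
  assumes "closed_seq 2 v" "v 0 \<noteq> v 1"
  shows "\<not> pentagram z v"
proof
  assume z: "pentagram z v"
  have v: "v (i + 2) = v i" for i using assms(1) by (simp add: closed_seq_def)
  have L: "subspace_of (v i) \<subseteq> line_through (z (i - 1)) (z (i + 1))"
    "subspace_of (v i) \<subseteq> line_through (z i) (z (i + 2))" "z i \<noteq> z (i + 2)"
    "line_through (z (i - 1)) (z (i + 1)) \<noteq> line_through (z i) (z (i + 2))" for i
    using z unfolding pentagram_def by blast+
  have "line_through (v 0) (v 1) = line_through (z 0) (z 2)"
    using L(2)[of 0] L(1)[of 1] L(3)[of 0] by (intro line_through_unique assms) (simp_all add: dim_line_through)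
  moreover have "line_through (v 0) (v 1) = line_through (z 1) (z 3)"
    using L(2)[of 1] L(1)[of 2] L(3)[of 1] v[of 0] by (intro line_through_unique assms) (simp_all add: dim_line_through)
  ultimately show False using L(4)[of 1] by simp
qed

text \<open>Each point of \<open>w\<close> lies on a line through two consecutive points of the
  collinear half of \<open>u\<close>, and this line is \<open>S\<close>. So all diagonals of
  \<open>w\<close> coincide.\<close>

lemma pentagram_undefined_after_collinear:
  assumes coll: "\<And>N. even N \<Longrightarrow> subspace_of (u (N + k)) \<subseteq> S" and S: "subspace S" "dim S = 2"
    and uw: "pentagram u w"
  shows "\<not> pentagram w x"
proof
  assume wx: "pentagram w x"
  have line: "line_through (u (N + k)) (u (N + k + 2)) = S" if "even N" for N
  proof (rule line_through_unique)
    show "u (N + k) \<noteq> u (N + k + 2)" using uw unfolding pentagram_def by blast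
    show "subspace_of (u (N + k)) \<subseteq> S" "subspace_of (u (N + k + 2)) \<subseteq> S"
      using coll[of N] coll[of "N + 2"] that by (simp_all add: algebra_simps)
  qed (use S in auto)
  have wS: "subspace_of (w i) \<subseteq> S" for i
  proof (cases "even (i - k)")
    case True
    then show ?thesis using pentagram_in_lines(2)[OF uw, of i] line[of "i - k"] by simp
  next
    case False
    then show ?thesis using pentagram_in_lines(1)[OF uw, of i] line[of "i - k - 1"]
      by (simp add: add.commute)
  qed
  have "line_through (w i) (w (i + 2)) = S" for i
    using wx wS S unfolding pentagram_def by (intro line_through_unique) auto
  from this[of 0] this[of "-1"] show False
    using wx[unfolded pentagram_def, rule_format, of 0] by simp
qed

text \<open>With \<open>n = m - 3\<close>, every second point is collinear after
  \<open>2 * n + 1\<close> steps and all points are after one more. The next step would be number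
  \<open>2 * n + 3 = 2 * m - 3\<close>.\<close>

lemma power_undefined:
  fixes e :: "real^3"
  assumes "m \<ge> 3" "closed_seq (2 * m) v" "e \<noteq> 0"
    and par: "\<And>i. even i \<Longrightarrow> v i \<noteq> v (i + 1) \<and> e \<in> line_through (v i) (v (i + 1))"
  shows "\<not> (pentagram ^^ (2 * m - 3)) v w"
proof
  assume "(pentagram ^^ (2 * m - 3)) v w"
  then obtain U where U: "U 0 = v" "\<And>k. k < 2 * m - 3 \<Longrightarrow> pentagram (U k) (U (Suc k))"
    unfolding relpowp_fun_conv by blast
  have U1: "pentagram v (U 1)" using U(1) U(2)[of 0] assms(1) by simp
  have U2: "pentagram (U 1) (U 2)" "pentagram (U 2) (U 3)"
    using U(2)[of 1] U(2)[of 2] assms(1) by (simp_all add: eval_nat_numeral)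
  have nc: "\<not> subspace_of (v (i + 1)) \<subseteq> line_through (v i) (v (i + 2))" for i
    using no_three_consecutive_collinear U1 U2 by blast
  have ne2: "v i \<noteq> v (i + 2)" for i using U1 unfolding pentagram_def by blast
  \<comment> \<open>If \<open>e\<close> represented \<open>v i\<close>, the side through
    \<open>v (i - 2)\<close> and \<open>v (i - 1)\<close> would contain three consecutive vertices,
    contrary to \<open>nc\<close>. For odd indices the following side is used.\<close>
  have e0: "e \<notin> subspace_of (v i)" if "even i" for i
  proof
    assume "e \<in> subspace_of (v i)"
    then have "subspace_of (v i) = span {e}" using assms(3) subspace_of_eq_span by blast
    then have "subspace_of (v i) \<subseteq> line_through (v (i - 2)) (v (i - 1))"
      using par[of "i - 2"] that by (simp add: span_minimal)
    then have "line_through (v (i - 2)) (v i) = line_through (v (i - 2)) (v (i - 1))"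
      using ne2[of "i - 2"] par[of "i - 2"] that
      by (intro line_through_unique) (simp_all add: left_in_line_through dim_line_through)
    then show False using nc[of "i - 2"] right_in_line_through[of "v (i - 1)" "v (i - 2)"] by simp
  qed
  have par2: "v (i + 2) \<noteq> v (i + 3)" "e \<in> line_through (v (i + 2)) (v (i + 3))" if "even i" for i
    using par[of "i + 2"] that by (simp_all add: add.assoc)
  have e1: "e \<notin> subspace_of (v (i + 1))" if "even i" for i
  proof
    assume "e \<in> subspace_of (v (i + 1))"
    then have "subspace_of (v (i + 1)) = span {e}" using assms(3) subspace_of_eq_span by blast
    then have "subspace_of (v (i + 1)) \<subseteq> line_through (v (i + 2)) (v (i + 3))"
      using par2[of i] that by (simp add: span_minimal)
    then have "line_through (v (i + 1)) (v (i + 3)) = line_through (v (i + 2)) (v (i + 3))"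
      using ne2[of "i + 1"] par2[of i] that
      by (intro line_through_unique) (simp_all add: add.assoc right_in_line_through dim_line_through)
    then show False using nc[of "i + 1"] left_in_line_through[of "v (i + 2)" "v (i + 3)"]
      by (simp add: add.assoc)
  qed
  \<comment> \<open>The lift is chosen as a function of the two points alone, so \<open>E\<close> is
    exactly periodic and not merely up to scalars.\<close>
  define lift where "lift = (\<lambda>p q. SOME x. subspace_of p = span {x} \<and> subspace_of q = span {x + e})"
  define E where "E = (\<lambda>r. lift (v (2 * r)) (v (2 * r + 1)))"
  have E: "subspace_of (v (2 * r)) = span {E r} \<and> subspace_of (v (2 * r + 1)) = span {E r + e}" for r
    unfolding E_def lift_def
    by (rule someI_ex, rule lift_with_difference) (use par[of "2 * r"] e0[of "2 * r"] e1[of "2 * r"] in simp_all)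
  define X where "X = (\<lambda>N. if even N then E (N div 2) else E (N div 2) + e)"
  have X: "subspace_of (v N) = span {X N}" for N
    using E[of "N div 2"] by (cases "even N") (simp_all add: X_def odd_two_times_div_two_succ)
  have X2: "X (2 * r) = E r" "X (2 * r + 1) = E r + e" "X (2 * r + 2) = E (r + 1)"
    "X (2 * r + 3) = E (r + 1) + e" "X (2 * r + 4) = E (r + 2)" for r
    by (simp_all add: X_def)
  have tr: "triple (X N) (X (N + 1)) (X (N + 2)) \<noteq> 0" for N
    by (rule triple_nonzero[OF X X X ne2 nc])
  have perE: "E (r + int m) = E r" for r
  proof -
    have "v (2 * (r + int m)) = v (2 * r)" "v (2 * (r + int m) + 1) = v (2 * r + 1)"
      using assms(2)[unfolded closed_seq_def, rule_format, of "2 * r"]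
        assms(2)[unfolded closed_seq_def, rule_format, of "2 * r + 1"] by (simp_all add: algebra_simps)
    then show ?thesis by (simp add: E_def)
  qed
  then have perE': "E (r + int m + k) = E (r + k)" for r k
    using perE[of "r + k"] by (simp add: ac_simps)
  \<comment> \<open>These are the coefficients of \<open>triple_relation\<close> for the lifts of
    \<open>v (2 * r + 1)\<close>, \<open>v (2 * r + 3)\<close>, \<open>v (2 * r + 2)\<close>,
    \<open>v (2 * r + 4)\<close>.\<close>
  define a where "a = (\<lambda>r. triple (E (r + 1) + e) (E (r + 1)) (E (r + 2)))"
  define b where "b = (\<lambda>r. - triple (E r + e) (E (r + 1)) (E (r + 2)))"
  define c where "c = (\<lambda>r. - triple (E r + e) (E (r + 1) + e) (E (r + 2)))"
  define d where "d = (\<lambda>r. triple (E r + e) (E (r + 1) + e) (E (r + 1)))"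
  interpret periodic_pencil m a b c d E e
  proof
    fix r
    show "a r *\<^sub>R (E r + e) + b r *\<^sub>R (E (r + 1) + e) = c r *\<^sub>R E (r + 1) + d r *\<^sub>R E (r + 2)"
    proof -
      have eq: "p *\<^sub>R x + (- q) *\<^sub>R y = (- s) *\<^sub>R z + t *\<^sub>R w"
        if "p *\<^sub>R x - q *\<^sub>R y + s *\<^sub>R z - t *\<^sub>R w = 0" for p q s t :: real and x y z w :: "real^3"
        using that by (simp add: algebra_simps)
      show ?thesis unfolding a_def b_def c_def d_def by (rule eq, rule triple_relation)
    qed
    have swap: "triple x y z = - triple x z y" for x y z
      unfolding triple_def by (metis cross_skew inner_minus_right)
    show "d r \<noteq> 0" using tr[of "2 * r + 1"] X2[of r]
      unfolding d_def by (subst swap) (simp add: add.assoc)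
    have "triple (E 0) (E 0 + e) (E 1) = - triple e (E 0) (E 1)"
      by (simp add: triple_def inner_vec_def sum_3 cross_components algebra_simps)
    then show "triple e (E 0) (E 1) \<noteq> 0" using tr[of 0] X2[of 0] by simp
  qed (use assms(1) perE perE' in \<open>simp_all add: a_def b_def c_def d_def\<close>)
  define n where "n = m - 3"
  obtain \<xi> t y where \<xi>: "\<xi> \<noteq> 0" and ty: "terminating n \<xi> t y"
    using terminating_exists unfolding n_def by blast
  \<comment> \<open>Columns \<open>2 * j\<close> and \<open>2 * j + 1\<close> both carry
    \<open>y j\<close>, raised by \<open>t j\<close> in the even one; thus column 0 carries \<xi>
    and column \<open>2 * n + 1\<close> is zero.\<close>
  define \<phi> where "\<phi> = (\<lambda>s N. y (s div 2) (N div 2) + (if even s then t (s div 2) else 0))"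
  have net: "planar_net X \<phi>"
    unfolding planar_net_def
  proof
    fix N :: int
    show "\<exists>a b c d. (a \<noteq> 0 \<or> b \<noteq> 0 \<or> c \<noteq> 0 \<or> d \<noteq> 0) \<and>
     a *\<^sub>R X N + b *\<^sub>R X (N + 2) = c *\<^sub>R X (N + 1) + d *\<^sub>R X (N + 3) \<and>
     (\<forall>s. even (int s + N) \<longrightarrow>
        a * \<phi> s N + b * \<phi> s (N + 2) = c * \<phi> (Suc s) (N + 1) + d * \<phi> (Suc s) (N + 3))"
    proof (cases "even N")
      case True
      then obtain r where N: "N = 2 * r" by blast
      \<comment> \<open>For even \<open>N\<close> the relation equates two differences, both equal
        to \<open>E r - E (r + 1)\<close>. The constants \<open>t j\<close> cancel in it, which is
        why they are free.\<close>
      show ?thesis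
        by (rule exI[of _ 1], rule exI[of _ "-1"], rule exI[of _ 1], rule exI[of _ "-1"])
          (auto simp: N X2 \<phi>_def)
    next
      case False
      then obtain r where N: "N = 2 * r + 1" by (rule oddE)
      have "a r * \<phi> s N + b r * \<phi> s (N + 2) = c r * \<phi> (Suc s) (N + 1) + d r * \<phi> (Suc s) (N + 3)"
        if "even (int s + N)" for s
      proof -
        have "odd s" using that N by simp
        then obtain j where "s = 2 * j + 1" by (rule oddE)
        then show ?thesis
          using ty[unfolded terminating_def] by (simp add: \<phi>_def N A_def B_def add.commute[of 1 r] add.commute[of 2 r])
      qed
      moreover have "a r *\<^sub>R X N + b r *\<^sub>R X (N + 2) = c r *\<^sub>R X (N + 1) + d r *\<^sub>R X (N + 3)"
      proof -
        have "N + 1 = 2 * r + 2" "N + 2 = 2 * r + 3" "N + 3 = 2 * r + 4" using N by simp_all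
        then show ?thesis using rel[of r] by (simp only: N X2)
      qed
      ultimately show ?thesis using d_nz[of r] by blast
    qed
  qed
  have first: "\<phi> 0 N = \<xi> \<bullet> X N" if "even N" for N
    using ty that by (simp add: \<phi>_def X_def terminating_def)
  have last: "\<phi> (2 * n + 1) N = 0" for N
    using ty by (simp add: \<phi>_def terminating_def)
  have steps: "pentagram (U k) (U (Suc k))" if "k < 2 * n + 3" for k
    using U(2) that assms(1) by (simp add: n_def)
  have "subspace_of (U (2 * n + 1) (N + int (2 * n + 1))) \<subseteq> {x. \<xi> \<bullet> x = 0}" if "even N" for N
  proof
    fix x
    assume x: "x \<in> subspace_of (U (2 * n + 1) (N + int (2 * n + 1)))"
    have "\<xi> \<bullet> x = 0"
      by (rule planar_net_iterate[OF net _ steps first last that x]) (simp_all add: U(1) X)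
    then show "x \<in> {x. \<xi> \<bullet> x = 0}" by simp
  qed
  moreover have "dim {x. \<xi> \<bullet> x = 0} = 2" using dim_hyperplane[OF \<xi>] by simp
  ultimately have "\<not> pentagram (U (Suc (2 * n + 1))) (U (Suc (Suc (2 * n + 1))))"
    using steps[of "2 * n + 1"]
    by (intro pentagram_undefined_after_collinear[where u = "U (2 * n + 1)"
        and k = "int (2 * n + 1)" and S = "{x. \<xi> \<bullet> x = 0}"])
      (simp_all add: subspace_hyperplane)
  then show False using steps[of "Suc (2 * n + 1)"] by simp
qed

theorem theorem9p6:
  fixes m :: nat and v :: "int \<Rightarrow> rp2"
  assumes "m \<ge> 1" and "m \<noteq> 2"
    and "closed_seq (2 * m) v"
    and "\<And>i. even i \<Longrightarrow>
           v i \<noteq> v (i + 1) \<and> parallel_to_x_axis (line_through (v i) (v (i + 1)))"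
    and "\<And>k :: nat. int k \<le> 2 * int m - 4 \<Longrightarrow> power_defined (int k) v"
  shows "(\<forall>w. pentagram_power (2 * int m - 4) v w \<longrightarrow> singular w) \<and>
         \<not> power_defined (2 * int m - 3) v"
proof (cases "m = 1")
  case True
  \<comment> \<open>Here the exponents are -2 and -1, so both powers ask for iterated preimages of
    \<open>v\<close>.\<close>
  have "\<not> pentagram z v" for z
    using no_backward_step_from_digon assms(3) assms(4)[of 0] True by simp
  then show ?thesis using True
    by (auto simp: pentagram_power_def power_defined_def eval_nat_numeral)
next
  case False
  then have m: "m \<ge> 3" using assms(1,2) by simp
  have undef: "\<not> (pentagram ^^ (2 * m - 3)) v w" for w
    by (rule power_undefined[of m v "axis 1 1"])
      (use m assms(3,4) in \<open>auto simp: parallel_to_x_axis_def axis_eq_0_iff\<close>)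
  \<comment> \<open>An image of the polygon after \<open>2 * m - 4\<close> steps would be an image
    of \<open>v\<close> after \<open>2 * m - 3\<close> steps.\<close>
  have "nat (2 * int m - 3) = 2 * m - 3" "nat (2 * int m - 4) = 2 * m - 4" "2 * m - 3 = Suc (2 * m - 4)"
    using m by simp_all
  then show ?thesis using undef m
    by (auto simp: pentagram_power_def power_defined_def singular_def intro: relpowp_Suc_I)
qed

end
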